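(* Let $0<\alpha<1$ and let $x:[0,\infty)\to\mathbb R$ be of exponential order, with Laplace transform $X(p)=\mathcal L\{x(t)\}(p)$. Then $$\mathcal L\{{}^c\mathcal D_\Phi^\alpha x\}(p)=\Phi(p,\Theta)^{\alpha-1}\big(pX(p)-x(0)\big)$$ (for those $p>0$ at which the Laplace transforms involved are defined).
   Context: $\mathcal L\{x(t)\}(p)=\int_0^\infty e^{-pt}x(t)\,dt$. A dynamic memory generator is a positive function $\Phi(p,\Theta)$ of the Laplace variable $p\in(0,\infty)$ and of fixed modulation parameters $\Theta$. For $\gamma>0$ the dynamic-memory kernel is $\Psi_\gamma(t;\Theta)=\mathcal L^{-1}\{\Phi(p,\Theta)^{-\gamma}\}(t)$, the locally integrable function on $(0,\infty)$ with $\mathcal L\{\Psi_\gamma(t;\Theta)\}(p)=\Phi(p,\Theta)^{-\gamma}$. For $0<\alpha<1$ the Caputo dynamic-memory fractional derivative is $({}^c\mathcal D_\Phi^\alpha x)(t)=\int_0^t\Psi_{1-\alpha}(t-s;\Theta)x'(s)\,ds$. Standing assumption: functions are sufficiently smooth so that the integrals, derivatives and Laplace transforms involved (in particular of $x'$) are well defined. *)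

theory Defs
  imports "HOL-Analysis.Analysis"
begin

text \<open>
  All integrals are Lebesgue integrals. Since the integral of a non-integrable function is the
  junk value 0, convergence of the Laplace integral is recorded separately.
\<close>

definition laplace_defined :: "(real \<Rightarrow> real) \<Rightarrow> real \<Rightarrow> bool" where
  "laplace_defined f p \<longleftrightarrow> set_integrable lebesgue {0<..} (\<lambda>t. exp (- (p * t)) * f t)"

definition laplace :: "(real \<Rightarrow> real) \<Rightarrow> real \<Rightarrow> real" where
  "laplace f p = (LINT t:{0<..}|lebesgue. exp (- (p * t)) * f t)"

definition memory_generator :: "(real \<Rightarrow> 'p \<Rightarrow> real) \<Rightarrow> 'p \<Rightarrow> bool" where
  "memory_generator \<Phi> \<Theta> \<longleftrightarrow> (\<forall>p>0. \<Phi> p \<Theta> > 0)"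

definition locally_integrable_pos :: "(real \<Rightarrow> real) \<Rightarrow> bool" where
  "locally_integrable_pos f \<longleftrightarrow>
     (\<forall>K. compact K \<and> K \<subseteq> {0<..} \<longrightarrow> set_integrable lebesgue K f)"

text \<open>
  The inverse Laplace transform determines the kernel only up to null sets, so being a kernel is a
  predicate on representatives \<open>\<psi>\<close> rather than a function of \<open>\<Phi>\<close>, \<open>\<Theta>\<close>, \<open>\<gamma>\<close>.
\<close>

definition memory_kernel :: "(real \<Rightarrow> 'p \<Rightarrow> real) \<Rightarrow> 'p \<Rightarrow> real \<Rightarrow> (real \<Rightarrow> real) \<Rightarrow> bool" where
  "memory_kernel \<Phi> \<Theta> \<gamma> \<psi> \<longleftrightarrow>
     locally_integrable_pos \<psi> \<and>
     (\<forall>p>0. laplace_defined \<psi> p \<and> laplace \<psi> p = \<Phi> p \<Theta> powr (- \<gamma>))"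

text \<open>
  The Caputo derivative of order \<open>\<alpha>\<close> is obtained by taking for \<open>\<psi>\<close> a kernel
  of index \<open>1 - \<alpha>\<close>. The values \<open>\<psi> 0\<close> and \<open>deriv x 0\<close> enter only at the
  endpoints of the interval, hence do not matter.
\<close>

definition caputo_memory :: "(real \<Rightarrow> real) \<Rightarrow> (real \<Rightarrow> real) \<Rightarrow> real \<Rightarrow> real" where
  "caputo_memory \<psi> x t = (LINT s:{0..t}|lebesgue. \<psi> (t - s) * deriv x s)"

definition exponential_order :: "(real \<Rightarrow> real) \<Rightarrow> bool" where
  "exponential_order x \<longleftrightarrow> (\<exists>M c T. \<forall>t\<ge>0. t \<ge> T \<longrightarrow> \<bar>x t\<bar> \<le> M * exp (c * t))"

end

theory Submission
  imports Defs
begin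

text \<open>
  For a kernel \<open>\<psi>\<close> the Caputo derivative is the convolution on the half-line of \<open>\<psi>\<close> with the
  derivative of \<open>x\<close>, and the Laplace transform turns convolutions into products. The claim
  is therefore the product of \<open>\<Phi>(p,\<Theta>) powr (\<alpha> - 1)\<close>, the transform of \<open>\<psi>\<close>, and \<open>p X(p) - x(0)\<close>, the transform
  of \<open>deriv x\<close>. Two facts carry this.

  The product rule (\<open>laplace_convolution\<close>) is Fubini's theorem for \<open>f(t - s) g(s)\<close>, where \<open>f\<close> and
  \<open>g\<close> are the functions damped by \<open>exp(- p t)\<close> and extended by zero to the negative axis: both
  are integrable on the line. Lebesgue measure on the line is complete, whereas Fubini's theorem
  needs measurability for the product \<open>\<sigma>\<close>-algebra; hence \<open>f\<close> and \<open>g\<close> are first replaced by Borel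
  functions that agree with them almost everywhere, which changes none of the integrals.

  The derivative rule (\<open>laplace_deriv\<close>) applies the fundamental theorem of calculus to
  \<open>g(t) = exp(- p t) x(t)\<close> on \<open>[0,b]\<close>, where \<open>g'\<close> is integrable on the half-line because the
  transforms of \<open>x\<close> and of \<open>deriv x\<close> converge at \<open>p\<close>. Consequently \<open>g(b)\<close> has a limit as \<open>b\<close>
  tends to infinity, and this limit is zero since \<open>g\<close> itself is integrable.
\<close>

section \<open>The transform of a derivative\<close>

text \<open>
  Otherwise the absolute value eventually exceeds some \<open>c > 0\<close>, so that its integral is at least
  \<open>c r\<close> for every length \<open>r\<close>. The limit cannot be dropped: an integrable function need not tend to
  zero at infinity.
\<close>

lemma limit_at_top_eq_0_if_integrable:
  fixes g :: "real \<Rightarrow> real"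
  assumes int: "set_integrable lebesgue {a..} g" and lim: "(g \<longlongrightarrow> L) at_top"
  shows "L = 0"
proof (rule ccontr)
  assume "L \<noteq> 0"
  define c where "c = \<bar>L\<bar> / 2"
  have "c > 0" "c < \<bar>L\<bar>"
    using \<open>L \<noteq> 0\<close> by (auto simp: c_def)
  have "((\<lambda>t. \<bar>g t\<bar>) \<longlongrightarrow> \<bar>L\<bar>) at_top"
    using lim by (rule tendsto_rabs)
  then have "eventually (\<lambda>t. c < \<bar>g t\<bar>) at_top"
    using \<open>c < \<bar>L\<bar>\<close> by (rule order_tendstoD)
  then have "eventually (\<lambda>t. c < \<bar>g t\<bar> \<and> t \<ge> a) at_top"
    by (intro eventually_conj eventually_ge_at_top)
  then obtain B where B: "\<And>t. t \<ge> B \<Longrightarrow> c < \<bar>g t\<bar> \<and> t \<ge> a"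
    by (auto simp: eventually_at_top_linorder)
  have "set_integrable lebesgue {a..} (\<lambda>t. \<bar>g t\<bar>)"
    using set_integrable_abs[OF int] .
  then have I: "integrable lebesgue (\<lambda>t. indicator {a..} t *\<^sub>R \<bar>g t\<bar>)"
    by (simp add: set_integrable_def)
  define J where "J = (LINT t|lebesgue. indicator {a..} t *\<^sub>R \<bar>g t\<bar>)"
  have bound: "c * r \<le> J" if "r \<ge> 0" for r :: real
  proof -
    have "(LINT t|lebesgue. c * indicator {B..B + r} t) \<le> J"
      unfolding J_def
    proof (rule integral_mono)
      show "integrable lebesgue (\<lambda>t. c * indicator {B..B + r} t)"
        by (intro integrable_mult_right integrable_real_indicator) (simp_all add: that)
      show "c * indicator {B..B + r} t \<le> indicator {a..} t *\<^sub>R \<bar>g t\<bar>" for t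
        using B[of t] by (auto simp: indicator_def)
    qed (rule I)
    then show ?thesis
      using that by simp
  qed
  have "J \<ge> 0"
    using bound[of 0] by simp
  then have "c * (J / c + 1) \<le> J"
    using \<open>c > 0\<close> by (intro bound) auto
  moreover have "c * (J / c + 1) = J + c"
    using \<open>c > 0\<close> by (simp add: distrib_left)
  ultimately show False
    using \<open>c > 0\<close> by simp
qed

text \<open>
  The derivative is integrable but possibly discontinuous, so this is not a classical integration
  by parts: the fundamental theorem in its gauge-integral form requires only differentiability in
  the open interval and continuity up to the endpoints, and the gauge integral agrees with the
  Lebesgue integral because the latter exists.
\<close>

lemma laplace_deriv:
  fixes x :: "real \<Rightarrow> real"
  assumes cont: "continuous_on {0..} x" and diff: "x differentiable_on {0<..}"
    and Lx: "laplace_defined x p" and Ldx: "laplace_defined (deriv x) p"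
  shows "laplace (deriv x) p = p * laplace x p - x 0"
proof -
  define g where "g t = exp (- (p * t)) * x t" for t
  define h where "h t = exp (- (p * t)) * deriv x t - p * (exp (- (p * t)) * x t)" for t
  \<comment> \<open>Extending \<open>h\<close> by zero at the origin, where \<open>x\<close> need not be differentiable, lets the closed intervals
    \<open>[0,b]\<close> of the fundamental theorem exhaust the domain of integration.\<close>
  define h0 where "h0 t = indicator {0<..} t *\<^sub>R h t" for t
  have int_h: "set_integrable lebesgue {0<..} h"
    unfolding h_def using Lx Ldx unfolding laplace_defined_def
    by (intro set_integral_diff set_integrable_mult_right)
  have value_h: "(LINT t:{0<..}|lebesgue. h t) = laplace (deriv x) p - p * laplace x p"
    unfolding h_def laplace_def using Lx Ldx unfolding laplace_defined_def
    by (subst set_integral_diff) (auto intro!: set_integrable_mult_right)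
  have h0_eq: "indicator {0..} t *\<^sub>R h0 t = indicator {0<..} t *\<^sub>R h t" for t
    by (auto simp: h0_def indicator_def)
  have int_h0: "set_integrable lebesgue {0..} h0"
    using int_h unfolding set_integrable_def h0_eq .
  have value_h0: "(LINT t:{0..}|lebesgue. h0 t) = (LINT t:{0<..}|lebesgue. h t)"
    unfolding set_lebesgue_integral_def h0_eq ..
  have ftc: "(LINT t:{0..b}|lebesgue. h0 t) = g b - g 0" if "b \<ge> 0" for b
  proof -
    have "(h0 has_integral (g b - g 0)) {0..b}"
    proof (rule fundamental_theorem_of_calculus_interior[OF that])
      show "continuous_on {0..b} g"
        unfolding g_def by (intro continuous_intros continuous_on_subset[OF cont]) auto
    next
      fix t assume t: "t \<in> {0<..<b}"
      have "x differentiable at t"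
        using diff t by (simp add: differentiable_on_eq_differentiable_at)
      then have "(x has_real_derivative deriv x t) (at t)"
        by (simp add: DERIV_deriv_iff_real_differentiable)
      then have "(g has_real_derivative h t) (at t)"
        unfolding g_def h_def by (auto intro!: derivative_eq_intros simp: algebra_simps)
      then show "(g has_vector_derivative h0 t) (at t)"
        using t by (simp add: h0_def has_real_derivative_iff_has_vector_derivative)
    qed
    moreover have "set_integrable lebesgue {0..b} h0"
      by (rule set_integrable_subset[OF int_h0]) auto
    ultimately show ?thesis
      by (simp add: set_lebesgue_integral_eq_integral(2) integral_unique)
  qed
  have "((\<lambda>b. LINT t:{0..b}|lebesgue. h0 t) \<longlongrightarrow> (LINT t:{0..}|lebesgue. h0 t)) at_top"
    by (rule tendsto_set_lebesgue_integral_at_top[OF _ int_h0]) auto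
  moreover have "eventually (\<lambda>b. (LINT t:{0..b}|lebesgue. h0 t) = g b - g 0) at_top"
    using eventually_ge_at_top[of 0] by eventually_elim (rule ftc)
  ultimately have "((\<lambda>b. g b - g 0) \<longlongrightarrow> (LINT t:{0<..}|lebesgue. h t)) at_top"
    unfolding value_h0 by (rule Lim_transform_eventually)
  then have "((\<lambda>b. g b - g 0 + g 0) \<longlongrightarrow> (LINT t:{0<..}|lebesgue. h t) + g 0) at_top"
    by (intro tendsto_intros)
  then have "(g \<longlongrightarrow> (LINT t:{0<..}|lebesgue. h t) + g 0) at_top"
    by simp
  moreover have "set_integrable lebesgue {1..} g"
    using Lx unfolding laplace_defined_def g_def by (rule set_integrable_subset) auto
  ultimately have "(LINT t:{0<..}|lebesgue. h t) + g 0 = 0"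
    by (rule limit_at_top_eq_0_if_integrable[rotated])
  then show ?thesis
    unfolding value_h by (simp add: g_def)
qed

section \<open>Convolution of integrable functions\<close>

text \<open>
  The absolute value of \<open>f(t - s) g(s)\<close> is integrable over the plane: by translation invariance
  the inner integral over \<open>t\<close> is the \<open>L\<^sup>1\<close> norm of \<open>f\<close> times \<open>\<bar>g(s)\<bar>\<close>. The order of integration
  may then be exchanged.
\<close>

lemma lborel_convolution:
  fixes f g :: "real \<Rightarrow> real"
  assumes f: "integrable lborel f" and g: "integrable lborel g"
  shows "integrable lborel (\<lambda>t. LINT s|lborel. f (t - s) * g s)"
    and "(LINT t|lborel. LINT s|lborel. f (t - s) * g s) = (LINT t|lborel. f t) * (LINT s|lborel. g s)"
proof -
  have [measurable]: "f \<in> borel_measurable borel" "g \<in> borel_measurable borel"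
    using f g by auto
  have shift: "integrable lborel (\<lambda>t. u (t - s))" "(LINT t|lborel. u (t - s)) = (LINT t|lborel. u t)"
    if "integrable lborel u" for u :: "real \<Rightarrow> real" and s
    using lborel_integrable_real_affine[OF that, of 1 "-s"]
      lborel_integral_real_affine[of 1 u "-s"] by simp_all
  have prod: "integrable (lborel \<Otimes>\<^sub>M lborel) (\<lambda>(s, t). f (t - s) * g s)"
  proof (rule lborel_pair.Fubini_integrable)
    have "(LINT t|lborel. norm (f (t - s) * g s)) = (LINT t|lborel. norm (f t)) * norm (g s)" for s
      using shift(2)[OF integrable_norm[OF f], of s] by (simp add: abs_mult)
    then show "integrable lborel (\<lambda>s. LINT t|lborel. norm (case (s, t) of (s, t) \<Rightarrow> f (t - s) * g s))"
      using g by simp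
    show "AE s in lborel. integrable lborel (\<lambda>t. case (s, t) of (s, t) \<Rightarrow> f (t - s) * g s)"
      using shift(1)[OF f] by simp
  qed measurable
  have "integrable (lborel \<Otimes>\<^sub>M lborel) (\<lambda>(t, s). f (t - s) * g s)"
    using lborel_pair.integrable_product_swap[OF prod] by simp
  then show "integrable lborel (\<lambda>t. LINT s|lborel. f (t - s) * g s)"
    using lborel_pair.integrable_fst'[of "\<lambda>(t, s). f (t - s) * g s"] by simp
  have "(LINT t|lborel. LINT s|lborel. f (t - s) * g s) = (LINT s|lborel. LINT t|lborel. f (t - s) * g s)"
    using lborel_pair.Fubini_integral[OF prod] by simp
  also have "\<dots> = (LINT s|lborel. (LINT t|lborel. f t) * g s)"
    using shift(2)[OF f] by simp
  finally show "(LINT t|lborel. LINT s|lborel. f (t - s) * g s) = (LINT t|lborel. f t) * (LINT s|lborel. g s)"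
    by simp
qed

lemma integrable_lebesgue_borel_version:
  fixes f :: "real \<Rightarrow> real"
  assumes f: "integrable lebesgue f"
  obtains f' where "integrable lborel f'" "AE t in lborel. f t = f' t"
    "(LINT t|lborel. f' t) = (LINT t|lebesgue. f t)"
proof -
  obtain f' where f': "f' \<in> borel_measurable lborel" "AE t in lborel. f t = f' t"
    using completion_ex_borel_measurable_real[OF borel_measurable_integrable[OF f]] by blast
  have ae: "AE t in lebesgue. f t = f' t"
    using f'(2) by (rule AE_completion)
  have meas: "f \<in> borel_measurable lebesgue" "f' \<in> borel_measurable lebesgue"
    using f f'(1) by (auto intro: measurable_completion)
  have "integrable lebesgue f'"
    using f integrable_cong_AE[OF meas ae] by simp
  then have "integrable lborel f'"
    using f'(1) by (simp add: integrable_completion)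
  moreover have "(LINT t|lborel. f' t) = (LINT t|lebesgue. f t)"
    using integral_cong_AE[OF meas ae] f'(1) by (simp add: integral_completion)
  ultimately show thesis
    using that f'(2) by blast
qed

lemma AE_lborel_reflect:
  fixes P :: "real \<Rightarrow> bool"
  assumes "AE s in lborel. P s"
  shows "AE s in lborel. P (t - s)"
proof -
  obtain N where N: "{s. \<not> P s} \<subseteq> N" "N \<in> null_sets lborel"
    using assms by (auto simp: eventually_ae_filter)
  then have [measurable]: "N \<in> sets borel"
    by auto
  have "AE s in lborel. s \<notin> N"
    using N(2) by (rule AE_not_in)
  then have "AE s in lborel. t + (-1) * s \<notin> N"
    by (intro AE_borel_affine[where P = "\<lambda>s. s \<notin> N"]) auto
  then show ?thesis
    by eventually_elim (use N(1) in auto)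
qed

text \<open>
  As Lebesgue measure is complete, either both functions are measurable or neither is; in the
  second case both integrals have the default value 0.
\<close>

lemma integral_lebesgue_cong_AE:
  fixes f g :: "real \<Rightarrow> real"
  assumes ae: "AE t in lebesgue. f t = g t"
  shows "(LINT t|lebesgue. f t) = (LINT t|lebesgue. g t)"
proof (cases "f \<in> borel_measurable lebesgue")
  case True
  with ae show ?thesis
    by (intro integral_cong_AE borel_measurable_AE[OF True]) auto
next
  case False
  have "AE t in lebesgue. g t = f t"
    using ae by eventually_elim simp
  then have "g \<notin> borel_measurable lebesgue"
    using False borel_measurable_AE by blast
  then have "\<not> integrable lebesgue f" "\<not> integrable lebesgue g"
    using False borel_measurable_integrable by blast+
  then show ?thesis
    by (simp add: not_integrable_integral_eq)
qed

text \<open>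
  For each fixed \<open>t\<close>, the reflection \<open>s \<mapsto> t - s\<close> preserves null sets, so passing to Borel versions
  of the two factors leaves the inner integral unchanged for every \<open>t\<close>, not just for almost
  every one.
\<close>

lemma lebesgue_convolution:
  fixes f g :: "real \<Rightarrow> real"
  assumes f: "integrable lebesgue f" and g: "integrable lebesgue g"
  shows "integrable lebesgue (\<lambda>t. LINT s|lebesgue. f (t - s) * g s)"
    and "(LINT t|lebesgue. LINT s|lebesgue. f (t - s) * g s) =
      (LINT t|lebesgue. f t) * (LINT s|lebesgue. g s)"
proof -
  obtain f' where f': "integrable lborel f'" "AE t in lborel. f t = f' t"
    "(LINT t|lborel. f' t) = (LINT t|lebesgue. f t)"
    using integrable_lebesgue_borel_version[OF f] .
  obtain g' where g': "integrable lborel g'" "AE t in lborel. g t = g' t"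
    "(LINT t|lborel. g' t) = (LINT t|lebesgue. g t)"
    using integrable_lebesgue_borel_version[OF g] .
  have [measurable]: "f' \<in> borel_measurable borel" "g' \<in> borel_measurable borel"
    using f'(1) g'(1) by auto
  have conv_eq: "(LINT s|lebesgue. f (t - s) * g s) = (LINT s|lborel. f' (t - s) * g' s)" for t
  proof -
    have "AE s in lborel. f' (t - s) * g' s = f (t - s) * g s"
      using AE_lborel_reflect[OF f'(2), of t] g'(2) by eventually_elim simp
    then have ae: "AE s in lebesgue. f' (t - s) * g' s = f (t - s) * g s"
      by (rule AE_completion)
    have "(\<lambda>s. f' (t - s) * g' s) \<in> borel_measurable lborel"
      by measurable
    then show ?thesis
      using integral_lebesgue_cong_AE[OF ae] by (simp add: integral_completion)
  qed
  note conv' = lborel_convolution[OF f'(1) g'(1)]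
  show "integrable lebesgue (\<lambda>t. LINT s|lebesgue. f (t - s) * g s)"
    unfolding conv_eq using conv'(1) by (simp add: integrable_completion)
  show "(LINT t|lebesgue. LINT s|lebesgue. f (t - s) * g s) =
      (LINT t|lebesgue. f t) * (LINT s|lebesgue. g s)"
    unfolding conv_eq using conv' f'(3) g'(3) by (simp add: integral_completion)
qed

section \<open>The transform of a convolution\<close>

text \<open>
  Damping is multiplicative, \<open>exp(- p (t - s)) exp(- p s) = exp(- p t)\<close>, and the zero extensions cut
  the integral over the line down to \<open>0 < s < t\<close>. Thus the convolution on the line of the damped
  functions is the damped convolution on the half-line.
\<close>

lemma laplace_convolution:
  fixes k y :: "real \<Rightarrow> real"
  assumes k: "laplace_defined k p" and y: "laplace_defined y p"
  defines "z \<equiv> (\<lambda>t. LINT s:{0..t}|lebesgue. k (t - s) * y s)"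
  shows "laplace_defined z p" and "laplace z p = laplace k p * laplace y p"
proof -
  define damped :: "(real \<Rightarrow> real) \<Rightarrow> real \<Rightarrow> real"
    where "damped u t = indicator {0<..} t *\<^sub>R (exp (- (p * t)) * u t)" for u t
  have conv: "(LINT s|lebesgue. damped k (t - s) * damped y s) = damped z t" for t
  proof (cases "t > 0")
    case False
    then have "(\<lambda>s. damped k (t - s) * damped y s) = (\<lambda>s. 0)"
      by (auto simp: damped_def indicator_def)
    then have "(LINT s|lebesgue. damped k (t - s) * damped y s) = 0"
      by simp
    then show ?thesis
      using False by (simp add: damped_def)
  next
    case True
    \<comment> \<open>The zero extensions vanish at the origin, so the integrands may differ at the two endpoints.\<close>
    have null: "{0, t} \<in> null_sets lborel"
      by (intro finite_imp_null_set_lborel) simp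
    have ptw: "damped k (t - s) * damped y s =
        exp (- (p * t)) * (indicator {0..t} s *\<^sub>R (k (t - s) * y s))" if "s \<notin> {0, t}" for s
      using that by (auto simp: damped_def indicator_def exp_diff exp_minus field_simps)
    have "AE s in lebesgue. s \<notin> {0, t}"
      using null AE_not_in AE_completion by blast
    then have ae: "AE s in lebesgue. damped k (t - s) * damped y s =
        exp (- (p * t)) * (indicator {0..t} s *\<^sub>R (k (t - s) * y s))"
      by eventually_elim (rule ptw)
    have "(LINT s|lebesgue. damped k (t - s) * damped y s) =
        (LINT s|lebesgue. exp (- (p * t)) * (indicator {0..t} s *\<^sub>R (k (t - s) * y s)))"
      using ae by (rule integral_lebesgue_cong_AE)
    also have "\<dots> = damped z t"
      using True by (simp add: damped_def z_def set_lebesgue_integral_def)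
    finally show ?thesis .
  qed
  have "integrable lebesgue (damped k)" "integrable lebesgue (damped y)"
    using k y unfolding laplace_defined_def set_integrable_def damped_def by simp_all
  note conv_thms = lebesgue_convolution[OF this]
  show "laplace_defined z p"
    using conv_thms(1) unfolding conv by (simp add: laplace_defined_def set_integrable_def damped_def)
  show "laplace z p = laplace k p * laplace y p"
    using conv_thms(2) unfolding conv
    by (simp add: laplace_def set_lebesgue_integral_def damped_def)
qed

section \<open>The transform of the Caputo dynamic-memory derivative\<close>

theorem theorem3p45:
  fixes \<Phi> :: "real \<Rightarrow> 'p \<Rightarrow> real" and \<Theta> :: 'p
    and \<psi> x :: "real \<Rightarrow> real" and \<alpha> p :: real
  assumes "memory_generator \<Phi> \<Theta>"
    and "0 < \<alpha>" and "\<alpha> < 1"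
    and "memory_kernel \<Phi> \<Theta> (1 - \<alpha>) \<psi>"
    and "continuous_on {0..} x"
    and "x differentiable_on {0<..}"
    and "exponential_order x"
    and "0 < p"
    and "laplace_defined x p"
    and "laplace_defined (deriv x) p"
  shows "laplace_defined (caputo_memory \<psi> x) p \<and>
         laplace (caputo_memory \<psi> x) p = \<Phi> p \<Theta> powr (\<alpha> - 1) * (p * laplace x p - x 0)"
proof -
  have \<psi>: "laplace_defined \<psi> p" "laplace \<psi> p = \<Phi> p \<Theta> powr (\<alpha> - 1)"
    using assms(4,8) by (auto simp: memory_kernel_def)
  have "caputo_memory \<psi> x = (\<lambda>t. LINT s:{0..t}|lebesgue. \<psi> (t - s) * deriv x s)"
    by (rule ext) (rule caputo_memory_def)
  moreover note laplace_convolution[OF \<psi>(1) assms(10)]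
    laplace_deriv[OF assms(5,6,9,10)]
  ultimately show ?thesis
    using \<psi>(2) by simp
qed

end
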